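(* Consider the planar map given in polar coordinates by $$r\mapsto f(r)=r+ar^3+\mathcal{O}(r^4),\qquad \varphi\mapsto g(\varphi,r)=\varphi+\Theta_0+br^2+\mathcal{O}(r^3),$$ with $a,b\in\mathbb{R}$, $a\neq0$, $\Theta_0=\frac{2\pi p}{q}$ for some $p,q\in\mathbb{Z}$, and $e^{in\Theta_0}\neq1$ for $n=1,2,3,4$. Then there exists $r_1>0$ small enough such that for every $0<r_0<r_1$ the discrete spiral $\Gamma(r_0,\varphi_0)$ is Minkowski nondegenerate and $$\dim_B\Gamma(r_0,\varphi_0)=\frac23 .$$
   Context: Discrete spiral: for $a<0$, $\Gamma(r_0,\varphi_0)$ is the set of points of $\mathbb{R}^2$ with polar coordinates $(r_k,\varphi_k)$, where $(r_0,\varphi_0)$ is given and $r_k=f(r_{k-1})$, $\varphi_k=g(\varphi_{k-1},r_{k-1})$ for $k\in\mathbb{N}$. For $a>0$ (origin unstable) the discrete spiral is taken to be the orbit of $(r_0,\varphi_0)$ under the local inverse of the map, so that in either case the points tend to the origin. Box dimension: for a bounded set $A\subset\mathbb{R}^N$ let $A_\varepsilon=\{y\in\mathbb{R}^N: d(y,A)<\varepsilon\}$, with Lebesgue measure $|A_\varepsilon|$. For $s\ge0$, $\mathcal{M}_*^s(A)=\liminf_{\varepsilon\to0}|A_\varepsilon|/\varepsilon^{N-s}$ and $\mathcal{M}^{*s}(A)=\limsup_{\varepsilon\to0}|A_\varepsilon|/\varepsilon^{N-s}$. The lower and upper box dimensions are $\underline{\dim}_BA=\inf\{s>0:\mathcal{M}_*^s(A)=0\}$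 and $\overline{\dim}_BA=\inf\{s>0:\mathcal{M}^{*s}(A)=0\}$; if they coincide the common value is $\dim_BA$. The set $A$ is Minkowski nondegenerate if there is $d\ge0$ with $0<\mathcal{M}_*^d(A)\le\mathcal{M}^{*d}(A)<\infty$ (then $d=\dim_BA$). *)

theory Defs
  imports "HOL-Analysis.Analysis" "HOL-Library.Landau_Symbols"
begin

section \<open>Minkowski contents and box dimension\<close>

text \<open>The condition \<open>A \<noteq> {}\<close> only matters because \<^const>\<open>infdist\<close> to the empty set is \<open>0\<close>.\<close>

definition eps_nbhd :: "real \<Rightarrow> 'a::euclidean_space set \<Rightarrow> 'a set" where
  "eps_nbhd \<epsilon> A = {y. A \<noteq> {} \<and> infdist y A < \<epsilon>}"

definition lower_Minkowski_content :: "real \<Rightarrow> 'a::euclidean_space set \<Rightarrow> ennreal" where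
  "lower_Minkowski_content s A =
     Liminf (at_right 0)
       (\<lambda>\<epsilon>. emeasure lebesgue (eps_nbhd \<epsilon> A) / ennreal (\<epsilon> powr (real DIM('a) - s)))"

definition upper_Minkowski_content :: "real \<Rightarrow> 'a::euclidean_space set \<Rightarrow> ennreal" where
  "upper_Minkowski_content s A =
     Limsup (at_right 0)
       (\<lambda>\<epsilon>. emeasure lebesgue (eps_nbhd \<epsilon> A) / ennreal (\<epsilon> powr (real DIM('a) - s)))"

text \<open>Both dimensions are meant for bounded \<open>A\<close>; every \<open>s > DIM('a)\<close> then belongs to the sets
  below, so the real-valued infima are proper.\<close>

definition lower_box_dim :: "'a::euclidean_space set \<Rightarrow> real" where
  "lower_box_dim A = Inf {s. 0 < s \<and> lower_Minkowski_content s A = 0}"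

definition upper_box_dim :: "'a::euclidean_space set \<Rightarrow> real" where
  "upper_box_dim A = Inf {s. 0 < s \<and> upper_Minkowski_content s A = 0}"

definition has_box_dim :: "'a::euclidean_space set \<Rightarrow> real \<Rightarrow> bool" where
  "has_box_dim A d \<longleftrightarrow> lower_box_dim A = d \<and> upper_box_dim A = d"

definition Minkowski_nondegenerate :: "'a::euclidean_space set \<Rightarrow> bool" where
  "Minkowski_nondegenerate A \<longleftrightarrow>
     (\<exists>d\<ge>0. 0 < lower_Minkowski_content d A \<and>
            lower_Minkowski_content d A \<le> upper_Minkowski_content d A \<and>
            upper_Minkowski_content d A < \<infinity>)"


section \<open>Planar maps in polar coordinates\<close>

text \<open>Polar coordinates are pairs \<open>(r, \<phi>)\<close>, with \<open>\<phi>\<close> a real number (not reduced modulo \<open>2\<pi>\<close>).\<close>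

definition polar_point :: "real \<times> real \<Rightarrow> real ^ 2" where
  "polar_point = (\<lambda>(r, \<phi>). vector [r * cos \<phi>, r * sin \<phi>])"

definition polar_map :: "(real \<Rightarrow> real) \<Rightarrow> (real \<Rightarrow> real \<Rightarrow> real) \<Rightarrow> real \<times> real \<Rightarrow> real \<times> real" where
  "polar_map f g = (\<lambda>(r, \<phi>). (f r, g \<phi> r))"

text \<open>The filter of punctured neighbourhoods of the origin: \<open>r\<close> tends to \<open>0\<close> from the right,
  uniformly in \<open>\<phi>\<close>.\<close>

definition polar_origin :: "(real \<times> real) filter" where
  "polar_origin = at_right 0 \<times>\<^sub>F top"

text \<open>\<open>G\<close> is a local inverse of \<open>F\<close> at the origin, as a germ. The limit condition puts
  \<open>G\<close> on the branch near the origin; without it \<open>F (G x) = x\<close> could hold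
  with \<open>G x\<close> far away.\<close>

definition polar_local_inverse ::
    "(real \<times> real \<Rightarrow> real \<times> real) \<Rightarrow> (real \<times> real \<Rightarrow> real \<times> real) \<Rightarrow> bool" where
  "polar_local_inverse F G \<longleftrightarrow>
     filterlim G polar_origin polar_origin \<and>
     (\<forall>\<^sub>F x in polar_origin. F (G x) = x) \<and>
     (\<forall>\<^sub>F x in polar_origin. G (F x) = x)"

definition polar_orbit :: "(real \<times> real \<Rightarrow> real \<times> real) \<Rightarrow> real \<times> real \<Rightarrow> (real ^ 2) set" where
  "polar_orbit F x = range (\<lambda>k. polar_point ((F ^^ k) x))"

text \<open>\<open>a\<close> is the cubic coefficient of the radial part of \<open>F\<close>, and \<open>G\<close> a local inverse
  of \<open>F\<close>, relevant only if \<open>a > 0\<close>, when the origin repels under \<open>F\<close>.\<close>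

definition discrete_spiral ::
    "real \<Rightarrow> (real \<times> real \<Rightarrow> real \<times> real) \<Rightarrow> (real \<times> real \<Rightarrow> real \<times> real) \<Rightarrow>
     real \<times> real \<Rightarrow> (real ^ 2) set" where
  "discrete_spiral a F G x = (if a < 0 then polar_orbit F x else polar_orbit G x)"

end

theory Submission
  imports Defs
begin

text \<open>
  Along the spiral the radius drops by an amount comparable to \<open>r ^ 3\<close> in each step, so
  \<open>1 / r\<^sup>2\<close> grows linearly and \<open>r\<close> decays like \<open>k powr (- 1/2)\<close>. The set of radii alone is
  thus a sequence on the line of box dimension \<open>2/3\<close>, and the spiral in the plane inherits this
  dimension for two reasons. Distances in the plane dominate differences of radii, so points that
  are separated radially are separated. Conversely, after \<open>\<bar>q\<bar>\<close> steps the rotation by \<open>\<Theta>\<^sub>0\<close> has made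
  full turns and only an angle \<open>O(r\<^sup>2)\<close> remains; the resulting displacement \<open>O(r ^ 3)\<close> is of the same
  order as the radial drop. Hence the spiral splits into \<open>\<bar>q\<bar>\<close> arms, on each of which the position
  is a Lipschitz function of the radius (lemma \<open>dist_pt_same_arm\<close>).

  Balls of radius \<open>\<epsilon> = s ^ 3\<close> around the spiral points separate while \<open>r\<close> exceeds a multiple
  of \<open>s\<close>, that is for about \<open>1 / s\<^sup>2\<close> steps (lemma \<open>volume_ge\<close>). What remains lies in \<open>\<bar>q\<bar>\<close> curves
  of length \<open>O(s)\<close> and is covered by \<open>O(s / \<epsilon>) = O(1 / s\<^sup>2)\<close> further balls of comparable radius
  (lemma \<open>volume_le\<close>). The area of the neighbourhood is therefore of exact order
  \<open>\<epsilon>\<^sup>2 / s\<^sup>2 = \<epsilon> powr (2 - 2/3)\<close>. The parameter \<open>s\<close> serves to keep all exponents integral.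

  The signs of \<open>a\<close> are treated together: the one-step bounds \<open>cubic_step\<close> hold for the map itself
  if \<open>a < 0\<close> and for a local inverse if \<open>a > 0\<close>, in the latter case with \<open>- \<Theta>\<^sub>0\<close> in place of \<open>\<Theta>\<^sub>0\<close>.
\<close>

section \<open>Minkowski content from two-sided volume bounds\<close>

lemma open_eps_nbhd: "open (eps_nbhd \<epsilon> A)"
proof (cases "A = {}")
  case False
  have "open {y. infdist y A < \<epsilon>}"
    by (intro open_Collect_less continuous_intros)
  then show ?thesis using False by (simp add: eps_nbhd_def)
qed (simp add: eps_nbhd_def)

lemma ball_subset_eps_nbhd:
  assumes "x \<in> A" shows "ball x \<epsilon> \<subseteq> eps_nbhd \<epsilon> A"
proof
  fix y assume "y \<in> ball x \<epsilon>"
  then have "infdist y A < \<epsilon>"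
    using infdist_le[OF assms, of y] by (simp add: dist_commute)
  then show "y \<in> eps_nbhd \<epsilon> A" using assms by (auto simp: eps_nbhd_def)
qed

lemma eps_nbhd_nearby_point:
  assumes "y \<in> eps_nbhd \<epsilon> A"
  obtains x where "x \<in> A" "dist y x < \<epsilon>"
proof -
  have ne: "A \<noteq> {}" and less: "infdist y A < \<epsilon>" using assms by (auto simp: eps_nbhd_def)
  have "(INF x\<in>A. dist y x) < \<epsilon>" using less ne by (simp add: infdist_notempty)
  moreover have "bdd_below (dist y ` A)" by (rule bdd_belowI[of _ 0]) auto
  ultimately obtain x where "x \<in> A" "dist y x < \<epsilon>"
    using ne by (auto simp: cINF_less_iff)
  then show ?thesis by (rule that)
qed

lemma Minkowski_content_quotient:
  assumes "0 < \<epsilon>" "0 \<le> K"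
  shows "ennreal (K * \<epsilon> powr (n - d)) / ennreal (\<epsilon> powr (n - s)) = ennreal (K * \<epsilon> powr (s - d))"
proof -
  have "ennreal (K * \<epsilon> powr (n - d)) / ennreal (\<epsilon> powr (n - s))
        = ennreal (K * \<epsilon> powr (n - d) / \<epsilon> powr (n - s))"
    using assms by (intro divide_ennreal) auto
  also have "K * \<epsilon> powr (n - d) / \<epsilon> powr (n - s) = K * \<epsilon> powr (s - d)"
    using assms by (simp add: powr_diff[symmetric] flip: times_divide_eq_right)
  finally show ?thesis .
qed

text \<open>With exponent \<open>s\<close> the defining quotient lies between constant multiples of
  \<open>\<epsilon> powr (s - d)\<close>, which stays away from \<open>0\<close> for \<open>s \<le> d\<close>, tends to \<open>0\<close> for \<open>s > d\<close>, and
  is constant for \<open>s = d\<close>.\<close>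

lemma Minkowski_nondegenerate_and_box_dim_if_volume_bounds:
  fixes A :: "'a::euclidean_space set"
  assumes d: "0 < d" and K1: "0 < K1" and K2: "0 \<le> K2"
    and lower: "\<forall>\<^sub>F \<epsilon> in at_right 0.
      ennreal (K1 * \<epsilon> powr (real DIM('a) - d)) \<le> emeasure lebesgue (eps_nbhd \<epsilon> A)"
    and upper: "\<forall>\<^sub>F \<epsilon> in at_right 0.
      emeasure lebesgue (eps_nbhd \<epsilon> A) \<le> ennreal (K2 * \<epsilon> powr (real DIM('a) - d))"
  shows "Minkowski_nondegenerate A \<and> has_box_dim A d"
proof -
  define Q where "Q s \<epsilon> = emeasure lebesgue (eps_nbhd \<epsilon> A) / ennreal (\<epsilon> powr (real DIM('a) - s))"
    for s \<epsilon> :: real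
  have low_def: "lower_Minkowski_content s A = Liminf (at_right 0) (Q s)" for s
    by (simp add: lower_Minkowski_content_def Q_def[abs_def])
  have up_def: "upper_Minkowski_content s A = Limsup (at_right 0) (Q s)" for s
    by (simp add: upper_Minkowski_content_def Q_def[abs_def])
  have small: "\<forall>\<^sub>F \<epsilon>::real in at_right 0. 0 < \<epsilon> \<and> \<epsilon> < 1"
    by (auto simp: eventually_at_right_field intro!: exI[of _ 1])
  have low_le_up: "lower_Minkowski_content s A \<le> upper_Minkowski_content s A" for s
    unfolding low_def up_def by (rule Liminf_le_Limsup) (rule trivial_limit_at_right_real)
  have Q_ge: "\<forall>\<^sub>F \<epsilon> in at_right 0. ennreal (K1 * \<epsilon> powr (s - d)) \<le> Q s \<epsilon>" for s
    using lower small
  proof eventually_elim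
    case (elim \<epsilon>)
    have "ennreal (K1 * \<epsilon> powr (s - d))
          = ennreal (K1 * \<epsilon> powr (real DIM('a) - d)) / ennreal (\<epsilon> powr (real DIM('a) - s))"
      using elim K1 by (simp add: Minkowski_content_quotient)
    also have "\<dots> \<le> Q s \<epsilon>"
      unfolding Q_def using elim by (intro divide_right_mono_ennreal) auto
    finally show ?case .
  qed
  have Q_le: "\<forall>\<^sub>F \<epsilon> in at_right 0. Q s \<epsilon> \<le> ennreal (K2 * \<epsilon> powr (s - d))" for s
    using upper small
  proof eventually_elim
    case (elim \<epsilon>)
    have "Q s \<epsilon> \<le> ennreal (K2 * \<epsilon> powr (real DIM('a) - d)) / ennreal (\<epsilon> powr (real DIM('a) - s))"
      unfolding Q_def using elim by (intro divide_right_mono_ennreal) auto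
    also have "\<dots> = ennreal (K2 * \<epsilon> powr (s - d))"
      using elim K2 by (simp add: Minkowski_content_quotient)
    finally show ?case .
  qed
  have low_pos: "0 < lower_Minkowski_content s A" if "s \<le> d" for s
  proof -
    have "\<forall>\<^sub>F \<epsilon> in at_right 0. ennreal K1 \<le> Q s \<epsilon>"
      using Q_ge[of s] small
    proof eventually_elim
      case (elim \<epsilon>)
      have "\<epsilon> powr 0 \<le> \<epsilon> powr (s - d)" using elim that by (intro powr_mono') auto
      then have "K1 \<le> K1 * \<epsilon> powr (s - d)" using elim K1 by simp
      then show ?case using elim by (meson ennreal_leI order_trans)
    qed
    then have "ennreal K1 \<le> lower_Minkowski_content s A"
      unfolding low_def by (rule Liminf_bounded)
    then show ?thesis using K1 by (metis ennreal_less_zero_iff order_less_le_trans)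
  qed
  have up_zero: "upper_Minkowski_content s A = 0" if "d < s" for s
  proof -
    have "((\<lambda>\<epsilon>. \<epsilon> powr (s - d)) \<longlongrightarrow> 0) (at_right 0)"
      using that eventually_mono[OF small, of "\<lambda>\<epsilon>. 0 \<le> \<epsilon>"]
      by (intro tendsto_zero_powrI[where b = "s - d"] tendsto_const tendsto_ident_at) auto
    then have "((\<lambda>\<epsilon>. ennreal (K2 * \<epsilon> powr (s - d))) \<longlongrightarrow> ennreal (K2 * 0)) (at_right 0)"
      by (intro tendsto_ennrealI tendsto_mult tendsto_const)
    then have "Limsup (at_right 0) (\<lambda>\<epsilon>. ennreal (K2 * \<epsilon> powr (s - d))) = 0"
      by (intro lim_imp_Limsup) (auto simp: trivial_limit_at_right_real)
    then show ?thesis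
      unfolding up_def using Limsup_mono[OF Q_le[of s]] by simp
  qed
  have up_finite: "upper_Minkowski_content d A < \<infinity>"
  proof -
    have "\<forall>\<^sub>F \<epsilon> in at_right 0. Q d \<epsilon> \<le> ennreal K2"
      using Q_le[of d] small by eventually_elim simp
    then have "upper_Minkowski_content d A \<le> ennreal K2"
      unfolding up_def by (rule Limsup_bounded)
    then show ?thesis by (simp add: order_le_less_trans)
  qed
  have "Minkowski_nondegenerate A"
    unfolding Minkowski_nondegenerate_def
    using d low_pos[of d] low_le_up up_finite by (intro exI[of _ d]) auto
  moreover have "0 < s \<and> lower_Minkowski_content s A = 0 \<longleftrightarrow> d < s"
    and "0 < s \<and> upper_Minkowski_content s A = 0 \<longleftrightarrow> d < s" for s
  proof -
    show "0 < s \<and> lower_Minkowski_content s A = 0 \<longleftrightarrow> d < s"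
      using low_pos[of s] up_zero[of s] low_le_up[of s] d by (cases "d < s") auto
    show "0 < s \<and> upper_Minkowski_content s A = 0 \<longleftrightarrow> d < s"
      using low_pos[of s] up_zero[of s] low_le_up[of s] d by (cases "d < s") auto
  qed
  ultimately show ?thesis
    by (simp add: has_box_dim_def lower_box_dim_def upper_box_dim_def flip: greaterThan_def)
qed

section \<open>Packing and covering bounds for the volume\<close>

lemma card_separated_le_volume:
  fixes x :: "'i \<Rightarrow> 'a::euclidean_space"
  assumes fin: "finite I" and sub: "x ` I \<subseteq> A" and \<epsilon>: "0 \<le> \<epsilon>"
    and sep: "\<And>i j. i \<in> I \<Longrightarrow> j \<in> I \<Longrightarrow> i \<noteq> j \<Longrightarrow> 2 * \<epsilon> \<le> dist (x i) (x j)"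
  shows "ennreal (real (card I) * (unit_ball_vol (real DIM('a)) * \<epsilon> ^ DIM('a)))
         \<le> emeasure lebesgue (eps_nbhd \<epsilon> A)"
proof -
  have disj: "disjoint_family_on (\<lambda>i. ball (x i) \<epsilon>) I"
    unfolding disjoint_family_on_def using sep by (auto simp: disjoint_ballI)
  have "ennreal (real (card I) * (unit_ball_vol (real DIM('a)) * \<epsilon> ^ DIM('a)))
        = (\<Sum>i\<in>I. ennreal (unit_ball_vol (real DIM('a)) * \<epsilon> ^ DIM('a)))"
    using \<epsilon> by (simp add: ennreal_mult'' ennreal_of_nat_eq_real_of_nat)
  also have "\<dots> = (\<Sum>i\<in>I. emeasure lebesgue (ball (x i) \<epsilon>))"
    using \<epsilon> by (simp add: emeasure_ball)
  also have "\<dots> = emeasure lebesgue (\<Union>i\<in>I. ball (x i) \<epsilon>)"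
    using fin disj by (intro sum_emeasure) auto
  also have "\<dots> \<le> emeasure lebesgue (eps_nbhd \<epsilon> A)"
    using sub ball_subset_eps_nbhd[of _ A \<epsilon>]
    by (intro emeasure_mono) (auto simp: open_eps_nbhd)
  finally show ?thesis .
qed

text \<open>A labelling whose classes have diameter at most \<open>D\<close> covers the neighbourhood by one ball
  of radius \<open>D + \<epsilon>\<close> per label.\<close>

lemma volume_le_card_labels:
  fixes x :: "'i \<Rightarrow> 'a::euclidean_space"
  assumes fin: "finite L" and lab: "\<And>i. label i \<in> L"
    and close: "\<And>i j. label i = label j \<Longrightarrow> dist (x i) (x j) \<le> D"
    and \<epsilon>: "0 \<le> \<epsilon>" and D: "0 \<le> D"
  shows "emeasure lebesgue (eps_nbhd \<epsilon> (range x))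
         \<le> ennreal (real (card L) * (unit_ball_vol (real DIM('a)) * (D + \<epsilon>) ^ DIM('a)))"
proof -
  define z where "z l = x (SOME i. label i = l)" for l
  have z: "dist (z (label i)) (x i) \<le> D" for i
    unfolding z_def by (rule close) (rule someI[of "\<lambda>j. label j = label i" i], simp)
  have "eps_nbhd \<epsilon> (range x) \<subseteq> (\<Union>l\<in>L. ball (z l) (D + \<epsilon>))"
  proof
    fix y assume "y \<in> eps_nbhd \<epsilon> (range x)"
    then obtain i where "dist y (x i) < \<epsilon>"
      by (metis eps_nbhd_nearby_point rangeE)
    then have "dist (z (label i)) y < D + \<epsilon>"
      using z[of i] dist_triangle[of "z (label i)" y "x i"] by (simp add: dist_commute)
    then show "y \<in> (\<Union>l\<in>L. ball (z l) (D + \<epsilon>))" using lab by auto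
  qed
  then have "emeasure lebesgue (eps_nbhd \<epsilon> (range x))
             \<le> emeasure lebesgue (\<Union>l\<in>L. ball (z l) (D + \<epsilon>))"
    by (intro emeasure_mono) (auto intro!: sets_completionI_sets borel_open open_UN)
  also have "\<dots> \<le> (\<Sum>l\<in>L. emeasure lebesgue (ball (z l) (D + \<epsilon>)))"
    using fin by (intro emeasure_subadditive_finite) auto
  also have "\<dots> = (\<Sum>l\<in>L. ennreal (unit_ball_vol (real DIM('a)) * (D + \<epsilon>) ^ DIM('a)))"
    using \<epsilon> D by (simp add: emeasure_ball)
  also have "\<dots> = ennreal (real (card L) * (unit_ball_vol (real DIM('a)) * (D + \<epsilon>) ^ DIM('a)))"
    using \<epsilon> D by (simp add: ennreal_mult'' ennreal_of_nat_eq_real_of_nat)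
  finally show ?thesis .
qed

section \<open>Distances in polar coordinates\<close>

lemma dist_polar_point:
  "dist (polar_point (r, \<phi>)) (polar_point (s, \<psi>)) ^ 2
   = (r - s)\<^sup>2 + 2 * r * s * (1 - cos (\<phi> - \<psi>))"
proof -
  have "dist (polar_point (r, \<phi>)) (polar_point (s, \<psi>)) ^ 2
        = (r * cos \<phi> - s * cos \<psi>)\<^sup>2 + (r * sin \<phi> - s * sin \<psi>)\<^sup>2"
    by (simp add: polar_point_def dist_norm norm_vec_def L2_set_def sum_2)
  also have "\<dots> = r\<^sup>2 * ((cos \<phi>)\<^sup>2 + (sin \<phi>)\<^sup>2) + s\<^sup>2 * ((cos \<psi>)\<^sup>2 + (sin \<psi>)\<^sup>2)
                  - 2 * r * s * (cos \<phi> * cos \<psi> + sin \<phi> * sin \<psi>)"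
    by (simp add: power2_diff power_mult_distrib algebra_simps del: sin_cos_squared_add sin_cos_squared_add2)
  also have "\<dots> = (r - s)\<^sup>2 + 2 * r * s * (1 - cos (\<phi> - \<psi>))"
    by (simp only: sin_cos_squared_add2 cos_diff) (simp add: power2_diff algebra_simps)
  finally show ?thesis .
qed

lemma radius_diff_le_dist_polar_point:
  assumes "0 \<le> r" "0 \<le> s"
  shows "\<bar>r - s\<bar> \<le> dist (polar_point (r, \<phi>)) (polar_point (s, \<psi>))"
proof (rule power2_le_imp_le)
  show "\<bar>r - s\<bar>\<^sup>2 \<le> dist (polar_point (r, \<phi>)) (polar_point (s, \<psi>)) ^ 2"
    using assms by (simp add: dist_polar_point)
qed simp

lemma one_minus_cos_le: "2 * (1 - cos x) \<le> (x::real)\<^sup>2"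
proof -
  have "\<bar>sin (x / 2)\<bar> \<le> \<bar>x / 2\<bar>" by (rule abs_sin_x_le_abs_x)
  then have "(sin (x / 2))\<^sup>2 \<le> (x / 2)\<^sup>2" by (metis abs_le_square_iff)
  moreover have "cos x = 1 - 2 * (sin (x / 2))\<^sup>2"
    using cos_double_sin[of "x / 2"] by simp
  ultimately show ?thesis by (simp add: power_divide)
qed

text \<open>Any representative of the angle difference modulo \<open>2 * pi\<close> may be used: the arms of the
  spiral close up only after full turns.\<close>

lemma dist_polar_point_le:
  assumes "0 \<le> s" "s \<le> r"
  shows "dist (polar_point (r, \<phi>)) (polar_point (s, \<psi>))
         \<le> (r - s) + r * \<bar>\<phi> - \<psi> - 2 * pi * of_int m\<bar>"
proof (rule power2_le_imp_le)
  define \<delta> where "\<delta> = \<phi> - \<psi> - 2 * pi * of_int m"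
  have "cos (\<phi> - \<psi>) = cos (\<delta> + 2 * pi * of_int m)" by (simp add: \<delta>_def)
  also have "\<dots> = cos \<delta>" by (simp add: cos_add)
  finally have "dist (polar_point (r, \<phi>)) (polar_point (s, \<psi>)) ^ 2
        = (r - s)\<^sup>2 + (r * s) * (2 * (1 - cos \<delta>))"
    by (simp add: dist_polar_point)
  also have "\<dots> \<le> (r - s)\<^sup>2 + (r * r) * \<delta>\<^sup>2"
    using assms one_minus_cos_le[of \<delta>] by (intro add_mono mult_mono mult_left_mono) auto
  also have "\<dots> \<le> ((r - s) + r * \<bar>\<delta>\<bar>)\<^sup>2"
    using assms by (simp add: power2_sum power_mult_distrib power2_eq_square[of r])
  finally show "dist (polar_point (r, \<phi>)) (polar_point (s, \<psi>)) ^ 2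
        \<le> ((r - s) + r * \<bar>\<phi> - \<psi> - 2 * pi * of_int m\<bar>)\<^sup>2"
    by (simp add: \<delta>_def)
qed (use assms in simp)

section \<open>Spirals with cubic radial decay\<close>

text \<open>Since \<open>\<theta>\<close> is a rational multiple of the full turn, \<open>q\<close> steps bring the angle back up to
  \<open>O(r\<^sup>2)\<close>. The bound on \<open>C * (r 0)\<^sup>2\<close> makes consecutive radii comparable.\<close>

locale cubic_spiral =
  fixes r \<phi> :: "nat \<Rightarrow> real" and c C \<theta> :: real and q :: nat and p :: int
  assumes c_pos: "0 < c"
    and r_pos: "\<And>k. 0 < r k"
    and decay_ge: "\<And>k. c * r k ^ 3 \<le> r k - r (Suc k)"
    and decay_le: "\<And>k. r k - r (Suc k) \<le> C * r k ^ 3"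
    and turn: "\<And>k. \<bar>\<phi> (Suc k) - \<phi> k - \<theta>\<bar> \<le> C * (r k)\<^sup>2"
    and start: "C * (r 0)\<^sup>2 \<le> 1 / 2"
    and q_pos: "0 < q"
    and resonance: "real q * \<theta> = 2 * pi * of_int p"
begin

definition pt :: "nat \<Rightarrow> real ^ 2" where
  "pt k = polar_point (r k, \<phi> k)"

lemma r_antimono: "k \<le> l \<Longrightarrow> r l \<le> r k"
proof (induction l rule: dec_induct)
  case (step n)
  have "0 \<le> c * r n ^ 3" using c_pos r_pos[of n] by simp
  then have "r (Suc n) \<le> r n" using decay_ge[of n] by linarith
  with step.IH show ?case by linarith
qed simp

lemma c_le_C: "c \<le> C"
proof -
  have "c * r 0 ^ 3 \<le> C * r 0 ^ 3" using decay_ge[of 0] decay_le[of 0] by linarith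
  moreover have "0 < r 0 ^ 3" using r_pos[of 0] by simp
  ultimately show ?thesis by (rule mult_right_le_imp_le)
qed

lemma C_pos: "0 < C"
  using c_pos c_le_C by linarith

lemma decay_ge_later:
  assumes "k < l" shows "c * r k ^ 3 \<le> r k - r l"
  using decay_ge[of k] r_antimono[of "Suc k" l] assms by linarith

lemma r_Suc_ge_half: "r k / 2 \<le> r (Suc k)"
proof -
  have "(r k)\<^sup>2 \<le> (r 0)\<^sup>2"
    using r_antimono[of 0 k] r_pos[of k] by (intro power_mono) auto
  then have "C * (r k)\<^sup>2 \<le> 1 / 2"
    using start C_pos by (meson mult_left_mono less_imp_le order_trans)
  then have "C * (r k)\<^sup>2 * r k \<le> 1 / 2 * r k"
    using r_pos[of k] by (intro mult_right_mono) auto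
  then show ?thesis using decay_le[of k]
    by (simp add: power2_eq_square power3_eq_cube mult_ac)
qed

text \<open>The substitution \<open>u = 1 / r\<^sup>2\<close> turns \<open>r' = - r ^ 3\<close> into \<open>u' = 2\<close>; its discrete version
  has increments between two positive constants.\<close>

lemma inverse_square_increment:
  shows "c \<le> 1 / (r (Suc k))\<^sup>2 - 1 / (r k)\<^sup>2"
    and "1 / (r (Suc k))\<^sup>2 - 1 / (r k)\<^sup>2 \<le> 8 * C"
proof -
  define x y where "x = r k" and "y = r (Suc k)"
  have x: "0 < x" and y: "0 < y" and yx: "y \<le> x" and xy: "x / 2 \<le> y"
    using r_pos r_antimono[of k "Suc k"] r_Suc_ge_half[of k] by (auto simp: x_def y_def)
  have lo: "c * x ^ 3 \<le> x - y" and hi: "x - y \<le> C * x ^ 3"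
    using decay_ge[of k] decay_le[of k] by (auto simp: x_def y_def)
  have eq: "1 / y\<^sup>2 - 1 / x\<^sup>2 = (x - y) * (x + y) / (x\<^sup>2 * y\<^sup>2)"
    using x y by (simp add: field_simps power2_eq_square)
  have "c * (x\<^sup>2 * y\<^sup>2) \<le> c * (x\<^sup>2 * x\<^sup>2)"
    using x y yx c_pos by (intro mult_left_mono power_mono) auto
  also have "\<dots> = (c * x ^ 3) * x" by (simp add: power2_eq_square power3_eq_cube)
  also have "\<dots> \<le> (x - y) * (x + y)"
    using lo x y yx c_pos by (intro mult_mono) auto
  finally show "c \<le> 1 / (r (Suc k))\<^sup>2 - 1 / (r k)\<^sup>2"
    using x y eq by (simp add: x_def y_def pos_le_divide_eq)
  have "(x - y) * (x + y) \<le> (C * x ^ 3) * (2 * x)"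
    using hi x y yx C_pos by (intro mult_mono) auto
  also have "\<dots> = 8 * C * (x\<^sup>2 * (x / 2)\<^sup>2)"
    by (simp add: power2_eq_square power3_eq_cube)
  also have "\<dots> \<le> 8 * C * (x\<^sup>2 * y\<^sup>2)"
    using x y xy C_pos by (intro mult_left_mono power_mono) auto
  finally show "1 / (r (Suc k))\<^sup>2 - 1 / (r k)\<^sup>2 \<le> 8 * C"
    using x y eq by (simp add: x_def y_def pos_divide_le_eq)
qed

lemma inverse_square_ge: "c * real k \<le> 1 / (r k)\<^sup>2"
proof (induction k)
  case (Suc k)
  then show ?case using inverse_square_increment(1)[of k] by (simp add: algebra_simps)
qed simp

lemma inverse_square_le: "1 / (r k)\<^sup>2 \<le> 1 / (r 0)\<^sup>2 + 8 * C * real k"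
proof (induction k)
  case (Suc k)
  then show ?case using inverse_square_increment(2)[of k] by (simp add: algebra_simps)
qed simp

lemma pt_separated:
  assumes "k \<noteq> l" "\<epsilon> \<le> c * r k ^ 3" "\<epsilon> \<le> c * r l ^ 3"
  shows "\<epsilon> \<le> dist (pt k) (pt l)"
proof -
  have "\<epsilon> \<le> \<bar>r k - r l\<bar>"
    using assms decay_ge_later[of k l] decay_ge_later[of l k] by (cases "k < l") auto
  also have "\<dots> \<le> dist (pt k) (pt l)"
    unfolding pt_def using r_pos[of k] r_pos[of l]
    by (intro radius_diff_le_dist_polar_point) auto
  finally show ?thesis .
qed

lemma turn_iterate: "\<bar>\<phi> (k + n) - \<phi> k - real n * \<theta>\<bar> \<le> real n * (C * (r k)\<^sup>2)"
proof (induction n)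
  case (Suc n)
  have "C * (r (k + n))\<^sup>2 \<le> C * (r k)\<^sup>2"
    using r_antimono[of k "k + n"] r_pos[of "k + n"] C_pos
    by (intro mult_left_mono power_mono) auto
  then show ?case using Suc turn[of "k + n"] by (simp add: algebra_simps abs_le_iff)
qed simp

definition arm_lipschitz :: real where
  "arm_lipschitz = 1 + real q * C / c"

lemma arm_lipschitz_pos: "0 < arm_lipschitz"
  using c_pos C_pos by (simp add: arm_lipschitz_def add_pos_nonneg)

text \<open>Both the radial and the tangential displacement over \<open>q\<close> steps have order \<open>r ^ 3\<close>, so the
  first controls the second. Every \<open>q\<close>-th point therefore lies on a Lipschitz curve
  parametrized by the radius.\<close>

lemma dist_pt_arm_step: "dist (pt k) (pt (k + q)) \<le> arm_lipschitz * (r k - r (k + q))"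
proof -
  have rad: "c * r k ^ 3 \<le> r k - r (k + q)" using q_pos by (intro decay_ge_later) simp
  have le: "r (k + q) \<le> r k" by (rule r_antimono) simp
  have "dist (pt k) (pt (k + q)) \<le> (r k - r (k + q)) + r k * \<bar>\<phi> k - \<phi> (k + q) - 2 * pi * of_int (- p)\<bar>"
    unfolding pt_def using r_pos[of "k + q"] le by (intro dist_polar_point_le) auto
  also have "\<bar>\<phi> k - \<phi> (k + q) - 2 * pi * of_int (- p)\<bar> = \<bar>\<phi> (k + q) - \<phi> k - real q * \<theta>\<bar>"
    by (simp add: resonance)
  also have "\<dots> \<le> real q * (C * (r k)\<^sup>2)" by (rule turn_iterate)
  finally have "dist (pt k) (pt (k + q)) \<le> (r k - r (k + q)) + r k * (real q * (C * (r k)\<^sup>2))"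
    using r_pos[of k] by (simp add: mult_left_mono)
  also have "r k * (real q * (C * (r k)\<^sup>2)) = real q * C / c * (c * r k ^ 3)"
    using c_pos by (simp add: power2_eq_square power3_eq_cube)
  also have "\<dots> \<le> real q * C / c * (r k - r (k + q))"
    using rad c_pos C_pos by (intro mult_left_mono) auto
  finally show ?thesis by (simp add: arm_lipschitz_def algebra_simps)
qed

lemma dist_pt_arm_iterate: "dist (pt k) (pt (k + n * q)) \<le> arm_lipschitz * (r k - r (k + n * q))"
proof (induction n)
  case (Suc n)
  have "dist (pt k) (pt (k + n * q + q))
        \<le> dist (pt k) (pt (k + n * q)) + dist (pt (k + n * q)) (pt (k + n * q + q))"
    by (rule dist_triangle)
  then show ?case using Suc dist_pt_arm_step[of "k + n * q"]
    by (simp add: algebra_simps)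
qed simp

lemma dist_pt_same_arm:
  assumes "k mod q = l mod q"
  shows "dist (pt k) (pt l) \<le> arm_lipschitz * \<bar>r k - r l\<bar>"
proof -
  have ordered: "dist (pt i) (pt j) \<le> arm_lipschitz * \<bar>r i - r j\<bar>"
    if le: "i \<le> j" and arm: "i mod q = j mod q" for i j
  proof -
    obtain n where "j = i + q * n"
      by (rule mod_eq_nat1E[of j q i]) (use le arm in auto)
    then show ?thesis using dist_pt_arm_iterate[of i n] r_antimono[OF le] by (simp add: mult.commute)
  qed
  show ?thesis
  proof (cases "k \<le> l")
    case True
    then show ?thesis using assms by (rule ordered)
  next
    case False
    then have "dist (pt l) (pt k) \<le> arm_lipschitz * \<bar>r l - r k\<bar>"
      using assms by (intro ordered) auto
    then show ?thesis
      by (simp only: dist_commute[of "pt k"] abs_minus_commute[of "r k"])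
  qed
qed

text \<open>The points with \<open>r \<ge> const * s\<close> are \<open>2 * s ^ 3\<close>-separated by the cubic decay of the
  radius, and there are about \<open>1 / s\<^sup>2\<close> of them. In the plane their disjoint balls of radius
  \<open>s ^ 3\<close> have total area of order \<open>s ^ 6 / s\<^sup>2 = s ^ 4\<close>.\<close>

lemma volume_ge:
  obtains K s0 where "0 < K" "0 < s0"
    "\<And>s. 0 < s \<Longrightarrow> s < s0 \<Longrightarrow>
       ennreal (K * s ^ 4) \<le> emeasure lebesgue (eps_nbhd (s ^ 3) (range pt))"
proof -
  \<comment> \<open>\<open>B\<close> is chosen so that \<open>r k \<ge> B * s\<close> gives \<open>c * r k ^ 3 \<ge> 2 * s ^ 3\<close>.\<close>
  define B where "B = root 3 (2 / c)"
  have B: "0 < B" and B3: "c * B ^ 3 = 2" using c_pos by (auto simp: B_def)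
  define \<kappa> where "\<kappa> = 1 / (16 * C * B\<^sup>2)"
  have \<kappa>: "0 < \<kappa>" using C_pos B by (simp add: \<kappa>_def)
  define s0 where "s0 = min (r 0 / (2 * B)) (sqrt (\<kappa> / 2))"
  have s0: "0 < s0" using r_pos[of 0] B \<kappa> by (simp add: s0_def)
  define V where "V = unit_ball_vol (real DIM(real ^ 2))"
  have V: "0 < V" by (simp add: V_def unit_ball_vol_pos)
  have "ennreal (\<kappa> / 2 * V * s ^ 4) \<le> emeasure lebesgue (eps_nbhd (s ^ 3) (range pt))"
    if s: "0 < s" "s < s0" for s
  proof -
    define N where "N = nat \<lfloor>\<kappa> / s\<^sup>2\<rfloor>"
    have "s\<^sup>2 < (sqrt (\<kappa> / 2))\<^sup>2" using s by (intro power_strict_mono) (auto simp: s0_def)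
    then have "2 \<le> \<kappa> / s\<^sup>2" using s \<kappa> by (simp add: field_simps)
    moreover have "y / 2 \<le> real (nat \<lfloor>y\<rfloor>)" if "2 \<le> y" for y :: real
      using that by linarith
    ultimately have N_ge: "\<kappa> / s\<^sup>2 / 2 \<le> real N" unfolding N_def by blast
    have N_le: "real N \<le> \<kappa> / s\<^sup>2" using \<kappa> unfolding N_def by simp
    have large: "2 * s ^ 3 \<le> c * r k ^ 3" if "k < N" for k
    proof -
      have "8 * C * real k \<le> 8 * C * (\<kappa> / s\<^sup>2)"
        using that N_le C_pos by (intro mult_left_mono) auto
      also have "\<dots> = 1 / (2 * (B * s)\<^sup>2)"
        using C_pos B s by (simp add: \<kappa>_def field_simps)
      finally have 1: "8 * C * real k \<le> 1 / (2 * (B * s)\<^sup>2)" .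
      have "2 * (B * s) \<le> r 0" using s B by (simp add: s0_def field_simps)
      then have "(2 * (B * s))\<^sup>2 \<le> (r 0)\<^sup>2" using B s by (intro power_mono) auto
      moreover have "2 * (B * s)\<^sup>2 \<le> (2 * (B * s))\<^sup>2" by simp
      ultimately have "2 * (B * s)\<^sup>2 \<le> (r 0)\<^sup>2" by linarith
      then have "1 / (r 0)\<^sup>2 \<le> 1 / (2 * (B * s)\<^sup>2)" using B s r_pos[of 0] by (intro divide_left_mono) auto
      with 1 inverse_square_le[of k] have "1 / (r k)\<^sup>2 \<le> 1 / (B * s)\<^sup>2"
        by (simp add: field_simps)
      then have "(B * s)\<^sup>2 \<le> (r k)\<^sup>2" using r_pos[of k] B s by (simp add: divide_simps split: if_splits)
      then have "B * s \<le> r k" using r_pos[of k] by (meson power2_le_imp_le less_imp_le)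
      then have "c * (B * s) ^ 3 \<le> c * r k ^ 3"
        using B s c_pos by (intro mult_left_mono power_mono) auto
      also have "c * (B * s) ^ 3 = (c * B ^ 3) * s ^ 3" by (simp add: power_mult_distrib)
      finally show ?thesis by (simp add: B3)
    qed
    have "\<kappa> / 2 * V * s ^ 4 = \<kappa> / s\<^sup>2 / 2 * (V * (s ^ 3) ^ 2)"
      using s by (simp add: field_simps flip: power_mult power_add)
    also have "\<dots> \<le> real (card {..<N}) * (V * (s ^ 3) ^ 2)"
      using N_ge V by (intro mult_right_mono) auto
    finally have "ennreal (\<kappa> / 2 * V * s ^ 4) \<le> ennreal (real (card {..<N}) * (V * (s ^ 3) ^ 2))"
      by (rule ennreal_leI)
    also have "\<dots> \<le> emeasure lebesgue (eps_nbhd (s ^ 3) (range pt))"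
      using card_separated_le_volume[of "{..<N}" pt "range pt" "s ^ 3"] large pt_separated s
      by (auto simp: V_def)
    finally show ?thesis .
  qed
  then show ?thesis using that[of "\<kappa> / 2 * V" s0] \<kappa> V s0 by simp
qed

text \<open>The first \<open>1 / s\<^sup>2\<close> points get a label each. The remaining points have radius \<open>O(s)\<close>; in
  each of the \<open>q\<close> arms they are grouped by the radial interval of length \<open>s ^ 3\<close> containing
  them, which by the Lipschitz property needs \<open>O(1 / s\<^sup>2)\<close> labels again.\<close>

lemma volume_le:
  obtains K where "0 \<le> K"
    "\<And>s. 0 < s \<Longrightarrow> s < 1 \<Longrightarrow>
       emeasure lebesgue (eps_nbhd (s ^ 3) (range pt)) \<le> ennreal (K * s ^ 4)"
proof -
  define V where "V = unit_ball_vol (real DIM(real ^ 2))"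
  have V: "0 < V" by (simp add: V_def unit_ball_vol_pos)
  define B where "B = 1 / sqrt c"
  have B: "0 < B" and B2: "B\<^sup>2 = 1 / c" using c_pos by (auto simp: B_def power_divide)
  define K where "K = (2 + real q * (B + 1)) * (V * (arm_lipschitz + 1)\<^sup>2)"
  have K: "0 \<le> K" using B V by (simp add: K_def)
  have "emeasure lebesgue (eps_nbhd (s ^ 3) (range pt)) \<le> ennreal (K * s ^ 4)"
    if s: "0 < s" "s < 1" for s
  proof -
    have s2: "0 < s\<^sup>2" "s\<^sup>2 < 1" using s by (auto simp: power_less_one_iff)
    have one_le: "1 \<le> 1 / s\<^sup>2" using s2 by simp
    define N where "N = nat \<lceil>1 / s\<^sup>2\<rceil>"
    have N_ge: "1 / s\<^sup>2 \<le> real N" unfolding N_def by linarith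
    have "real N \<le> 1 / s\<^sup>2 + 1" using one_le unfolding N_def by linarith
    then have N_le: "real N \<le> 2 / s\<^sup>2" using one_le by simp
    define M where "M = nat \<lfloor>B / s\<^sup>2\<rfloor>"
    have M_le: "real M \<le> B / s\<^sup>2" using B s unfolding M_def by simp
    \<comment> \<open>\<open>B * s\<close> bounds the radii from index \<open>N\<close> on, so the interval numbers there are at most \<open>M\<close>.\<close>
    define interval where "interval k = nat \<lfloor>r k / s ^ 3\<rfloor>" for k
    define label where
      "label k = (if k < N then Inl k else Inr (k mod q, interval k))" for k
    define L where "L = {..<N} <+> ({..<q} \<times> {..M})"
    have tail: "r k \<le> B * s" if "N \<le> k" for k
    proof -
      have "c / s\<^sup>2 \<le> c * real N" using mult_left_mono[OF N_ge, of c] c_pos by simp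
      also have "\<dots> \<le> c * real k" using that c_pos by simp
      also have "\<dots> \<le> 1 / (r k)\<^sup>2" by (rule inverse_square_ge)
      finally have "(r k)\<^sup>2 \<le> (B * s)\<^sup>2"
        using r_pos[of k] s c_pos by (simp add: B2 power_mult_distrib field_simps)
      then show ?thesis using B s by (meson power2_le_imp_le mult_pos_pos less_imp_le)
    qed
    have "label k \<in> L" for k
    proof (cases "k < N")
      case False
      then have "r k / s ^ 3 \<le> B * s / s ^ 3" using tail s by (intro divide_right_mono) auto
      also have "\<dots> = B / s\<^sup>2" using s by (simp add: power2_eq_square power3_eq_cube)
      finally have "interval k \<le> M" unfolding interval_def M_def by (intro nat_mono floor_mono)
      then show ?thesis using False q_pos by (auto simp: label_def L_def)
    qed (auto simp: label_def L_def)
    moreover have "dist (pt k) (pt l) \<le> arm_lipschitz * s ^ 3" if lab: "label k = label l" for k l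
    proof (cases "k = l")
      case True
      then show ?thesis using arm_lipschitz_pos s by simp
    next
      case False
      then have arm: "k mod q = l mod q" and int: "interval k = interval l"
        using lab by (auto simp: label_def split: if_splits)
      have "0 \<le> r i / s ^ 3" for i using r_pos[of i] s by simp
      then have "\<lfloor>r k / s ^ 3\<rfloor> = \<lfloor>r l / s ^ 3\<rfloor>"
        using int unfolding interval_def by (simp add: eq_nat_nat_iff)
      then have "\<bar>r k / s ^ 3 - r l / s ^ 3\<bar> \<le> 1" by linarith
      then have "\<bar>r k - r l\<bar> \<le> s ^ 3"
        using s by (simp flip: diff_divide_distrib add: abs_divide divide_le_eq)
      then have "arm_lipschitz * \<bar>r k - r l\<bar> \<le> arm_lipschitz * s ^ 3"
        using arm_lipschitz_pos by simp
      then show ?thesis using dist_pt_same_arm[OF arm] by linarith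
    qed
    ultimately have vol: "emeasure lebesgue (eps_nbhd (s ^ 3) (range pt))
        \<le> ennreal (real (card L) * (V * (arm_lipschitz * s ^ 3 + s ^ 3) ^ 2))"
      using volume_le_card_labels[of L label pt "arm_lipschitz * s ^ 3" "s ^ 3"]
        s arm_lipschitz_pos by (simp add: L_def V_def)
    have "real (card L) = real N + real q * (real M + 1)"
      by (simp add: L_def card_Plus distrib_left)
    also have "\<dots> \<le> 2 / s\<^sup>2 + real q * (B / s\<^sup>2 + 1 / s\<^sup>2)"
      using N_le M_le one_le by (intro add_mono mult_left_mono) auto
    also have "\<dots> = (2 + real q * (B + 1)) / s\<^sup>2"
      by (simp add: add_divide_distrib distrib_left)
    finally have "real (card L) * (V * (arm_lipschitz * s ^ 3 + s ^ 3) ^ 2)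
        \<le> (2 + real q * (B + 1)) / s\<^sup>2 * (V * (arm_lipschitz * s ^ 3 + s ^ 3) ^ 2)"
      using V by (intro mult_right_mono) auto
    also have "\<dots> = (2 + real q * (B + 1)) / s\<^sup>2 * (V * ((arm_lipschitz + 1) * s ^ 3) ^ 2)"
      by (simp add: algebra_simps)
    also have "\<dots> = K * (s ^ 6 / s\<^sup>2)"
      by (simp add: K_def power_mult_distrib flip: power_mult)
    also have "s ^ 6 / s\<^sup>2 = s ^ 4" using s by (simp add: field_simps flip: power_add)
    finally show ?thesis using vol by (meson ennreal_leI order_trans)
  qed
  then show ?thesis using that K by blast
qed

lemma nondegenerate_and_box_dim:
  "Minkowski_nondegenerate (range pt) \<and> has_box_dim (range pt) (2 / 3)"
proof -
  obtain K1 s0 where K1: "0 < K1" and s0: "0 < s0" and low: "\<And>s. 0 < s \<Longrightarrow> s < s0 \<Longrightarrow>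
       ennreal (K1 * s ^ 4) \<le> emeasure lebesgue (eps_nbhd (s ^ 3) (range pt))"
    by (rule volume_ge) blast
  obtain K2 where K2: "0 \<le> K2" and up: "\<And>s. 0 < s \<Longrightarrow> s < 1 \<Longrightarrow>
       emeasure lebesgue (eps_nbhd (s ^ 3) (range pt)) \<le> ennreal (K2 * s ^ 4)"
    by (rule volume_le) blast
  have root: "root 3 \<epsilon> ^ 3 = \<epsilon>" "root 3 \<epsilon> ^ 4 = \<epsilon> powr (4 / 3)" "0 < root 3 \<epsilon>"
    if "0 < \<epsilon>" for \<epsilon> :: real
    using that by (auto simp: root_powr_inverse powr_powr simp flip: powr_numeral)
  have tiny: "\<forall>\<^sub>F \<epsilon> in at_right 0. 0 < \<epsilon> \<and> root 3 \<epsilon> < t" if "0 < t" for t :: real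
  proof -
    have "root 3 \<epsilon> < t" if "\<epsilon> < t ^ 3" for \<epsilon>
    proof -
      have "root 3 \<epsilon> < root 3 (t ^ 3)" using that by simp
      then show ?thesis using \<open>0 < t\<close> by (simp add: real_root_power_cancel)
    qed
    then show ?thesis using that
      by (auto simp: eventually_at_right_field intro!: exI[of _ "t ^ 3"])
  qed
  show ?thesis
  proof (rule Minkowski_nondegenerate_and_box_dim_if_volume_bounds[OF _ K1 K2])
    show "\<forall>\<^sub>F \<epsilon> in at_right 0. ennreal (K1 * \<epsilon> powr (real DIM(real ^ 2) - 2 / 3))
        \<le> emeasure lebesgue (eps_nbhd \<epsilon> (range pt))"
      using tiny[OF s0]
    proof eventually_elim
      case (elim \<epsilon>)
      then show ?case using low[of "root 3 \<epsilon>"] root[of \<epsilon>] by simp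
    qed
    show "\<forall>\<^sub>F \<epsilon> in at_right 0. emeasure lebesgue (eps_nbhd \<epsilon> (range pt))
        \<le> ennreal (K2 * \<epsilon> powr (real DIM(real ^ 2) - 2 / 3))"
      using tiny[OF zero_less_one]
    proof eventually_elim
      case (elim \<epsilon>)
      then show ?case using up[of "root 3 \<epsilon>"] root[of \<epsilon>] by simp
    qed
  qed simp
qed

end

section \<open>Orbits of the map and of its local inverse\<close>

lemma eventually_polar_origin:
  "eventually P polar_origin \<longleftrightarrow> (\<exists>\<delta>>0. \<forall>r \<phi>. 0 < r \<and> r < \<delta> \<longrightarrow> P (r, \<phi>))"
proof -
  have "eventually P polar_origin \<longleftrightarrow> (\<forall>\<^sub>F r in at_right 0. \<forall>\<phi>. P (r, \<phi>))"
    unfolding polar_origin_def eventually_prod_filter eventually_top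
    by (auto elim: eventually_mono)
  also have "\<dots> \<longleftrightarrow> (\<exists>\<delta>>0. \<forall>r \<phi>. 0 < r \<and> r < \<delta> \<longrightarrow> P (r, \<phi>))"
    by (auto simp: eventually_at_right_field)
  finally show ?thesis .
qed

text \<open>What \<^locale>\<open>cubic_spiral\<close> asks of one step of an orbit.\<close>

definition cubic_step :: "real \<Rightarrow> real \<Rightarrow> real \<Rightarrow> real \<times> real \<Rightarrow> real \<times> real \<Rightarrow> bool" where
  "cubic_step c C \<theta> x y \<longleftrightarrow>
     c * fst x ^ 3 \<le> fst x - fst y \<and> fst x - fst y \<le> C * fst x ^ 3 \<and>
     \<bar>snd y - snd x - \<theta>\<bar> \<le> C * (fst x)\<^sup>2"

lemma polar_orbit_nondegenerate_and_box_dim: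
  assumes c: "0 < c" and q: "0 < q" and res: "real q * \<theta> = 2 * pi * of_int p"
    and step: "\<forall>\<^sub>F x in polar_origin. cubic_step c C \<theta> x (H x)"
  shows "\<exists>r1>0. \<forall>r0 \<phi>0. 0 < r0 \<and> r0 < r1 \<longrightarrow>
    Minkowski_nondegenerate (polar_orbit H (r0, \<phi>0)) \<and> has_box_dim (polar_orbit H (r0, \<phi>0)) (2 / 3)"
proof -
  obtain \<delta> where \<delta>: "0 < \<delta>"
    and step': "\<And>r \<phi>. 0 < r \<Longrightarrow> r < \<delta> \<Longrightarrow> cubic_step c C \<theta> (r, \<phi>) (H (r, \<phi>))"
    using step unfolding eventually_polar_origin by blast
  define r1 where "r1 = min \<delta> (1 / sqrt (2 * (\<bar>C\<bar> + 1)))"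
  have r1: "0 < r1" using \<delta> by (simp add: r1_def)
  have Cr: "C * r\<^sup>2 \<le> 1 / 2" if "0 < r" "r < r1" for r
  proof -
    have "r\<^sup>2 \<le> (1 / sqrt (2 * (\<bar>C\<bar> + 1)))\<^sup>2"
      using that by (intro power_mono) (auto simp: r1_def)
    then have "r\<^sup>2 \<le> 1 / (2 * (\<bar>C\<bar> + 1))" by (simp add: power_divide)
    then have "(\<bar>C\<bar> + 1) * r\<^sup>2 \<le> 1 / 2" by (simp add: field_simps)
    moreover have "C * r\<^sup>2 \<le> (\<bar>C\<bar> + 1) * r\<^sup>2" by (intro mult_right_mono) auto
    ultimately show ?thesis by linarith
  qed
  have orbit: "Minkowski_nondegenerate (polar_orbit H (r0, \<phi>0)) \<and> has_box_dim (polar_orbit H (r0, \<phi>0)) (2 / 3)"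
    if r0: "0 < r0" "r0 < r1" for r0 \<phi>0
  proof -
    define x where "x k = (H ^^ k) (r0, \<phi>0)" for k
    have x_Suc: "x (Suc k) = H (x k)" for k by (simp add: x_def)
    have x_step: "cubic_step c C \<theta> (x k) (x (Suc k))" if "0 < fst (x k)" "fst (x k) < r1" for k
      using step'[of "fst (x k)" "snd (x k)"] that by (simp add: x_Suc r1_def)
    have inv: "0 < fst (x k) \<and> fst (x k) < r1" for k
    proof (induction k)
      case 0
      then show ?case using r0 by (simp add: x_def)
    next
      case (Suc k)
      define r where "r = fst (x k)"
      have r: "0 < r" "r < r1" using Suc by (auto simp: r_def)
      have st: "c * r ^ 3 \<le> r - fst (x (Suc k))" "r - fst (x (Suc k)) \<le> C * r ^ 3"
        using x_step[of k] Suc by (auto simp: cubic_step_def r_def)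
      have "0 \<le> c * r ^ 3" using c r by simp
      moreover have "C * r\<^sup>2 * r \<le> 1 / 2 * r" using Cr r by (intro mult_right_mono) auto
      then have "C * r ^ 3 \<le> r / 2" by (simp add: power2_eq_square power3_eq_cube mult_ac)
      ultimately show ?case using st r by linarith
    qed
    interpret cubic_spiral "\<lambda>k. fst (x k)" "\<lambda>k. snd (x k)" c C \<theta> q p
    proof
      show "C * (fst (x 0))\<^sup>2 \<le> 1 / 2" using Cr inv by blast
    qed (use c q res inv x_step in \<open>auto simp: cubic_step_def\<close>)
    have "polar_orbit H (r0, \<phi>0) = range (\<lambda>k. polar_point (x k))"
      by (simp add: polar_orbit_def x_def)
    also have "\<dots> = range pt" by (simp add: pt_def)
    finally show ?thesis using nondegenerate_and_box_dim by simp
  qed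
  then show ?thesis using r1 by blast
qed

text \<open>Near the origin the cubic radial term dominates the quartic remainder, whence the factor \<open>1/2\<close>.
  In the angle the twist and its remainder are together \<open>O(r\<^sup>2)\<close>.\<close>

lemma polar_map_cubic_asymptotics:
  assumes a: "a \<noteq> 0"
    and f: "(\<lambda>r. f r - (r + a * r ^ 3)) \<in> O[at_right 0](\<lambda>r. r ^ 4)"
    and g: "(\<lambda>(r, \<phi>). g \<phi> r - (\<phi> + \<theta> + b * r ^ 2)) \<in> O[polar_origin](\<lambda>(r, \<phi>). r ^ 3)"
  obtains C where "0 < C"
    "\<forall>\<^sub>F (r, \<phi>) in polar_origin. 0 < r \<and> \<bar>f r - r - a * r ^ 3\<bar> \<le> \<bar>a\<bar> / 2 * r ^ 3 \<and>
       \<bar>g \<phi> r - \<phi> - \<theta>\<bar> \<le> C * r\<^sup>2"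
proof -
  obtain M where M: "0 < M"
    and "\<forall>\<^sub>F r in at_right 0. norm (f r - (r + a * r ^ 3)) \<le> M * norm (r ^ 4)"
    using landau_o.bigE[OF f] by blast
  then obtain d1 where d1: "0 < d1"
    and f': "\<And>r. 0 < r \<Longrightarrow> r < d1 \<Longrightarrow> \<bar>f r - (r + a * r ^ 3)\<bar> \<le> M * r ^ 4"
    unfolding eventually_at_right_field by (auto simp: abs_mult)
  obtain M' where M': "0 < M'"
    and "\<forall>\<^sub>F x in polar_origin. norm ((\<lambda>(r, \<phi>). g \<phi> r - (\<phi> + \<theta> + b * r ^ 2)) x)
           \<le> M' * norm ((\<lambda>(r, \<phi>). r ^ 3) x)"
    using landau_o.bigE[OF g] by blast
  then obtain d2 where d2: "0 < d2"
    and g': "\<And>r \<phi>. 0 < r \<Longrightarrow> r < d2 \<Longrightarrow> \<bar>g \<phi> r - (\<phi> + \<theta> + b * r ^ 2)\<bar> \<le> M' * r ^ 3"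
    unfolding eventually_polar_origin by auto
  define \<delta> where "\<delta> = min (min d1 d2) (min 1 (\<bar>a\<bar> / (2 * M)))"
  have \<delta>: "0 < \<delta>" using d1 d2 a M by (simp add: \<delta>_def)
  have main: "\<bar>f r - r - a * r ^ 3\<bar> \<le> \<bar>a\<bar> / 2 * r ^ 3 \<and> \<bar>g \<phi> r - \<phi> - \<theta>\<bar> \<le> (\<bar>b\<bar> + M') * r\<^sup>2"
    if r: "0 < r" "r < \<delta>" for r \<phi>
  proof
    have "M * r \<le> \<bar>a\<bar> / 2" using r M by (simp add: \<delta>_def field_simps)
    then have "M * r * r ^ 3 \<le> \<bar>a\<bar> / 2 * r ^ 3" using r by (intro mult_right_mono) auto
    moreover have "M * r * r ^ 3 = M * r ^ 4" by (simp add: power_numeral_reduce)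
    moreover have "\<bar>f r - r - a * r ^ 3\<bar> \<le> M * r ^ 4"
      using f'[of r] r by (simp add: \<delta>_def diff_diff_eq)
    ultimately show "\<bar>f r - r - a * r ^ 3\<bar> \<le> \<bar>a\<bar> / 2 * r ^ 3" by linarith
    have "M' * r ^ 3 \<le> M' * r\<^sup>2"
      using r M' by (intro mult_left_mono power_decreasing) (auto simp: \<delta>_def)
    moreover have "\<bar>b * r\<^sup>2\<bar> = \<bar>b\<bar> * r\<^sup>2" by (simp add: abs_mult)
    ultimately show "\<bar>g \<phi> r - \<phi> - \<theta>\<bar> \<le> (\<bar>b\<bar> + M') * r\<^sup>2"
      using g'[of r \<phi>] r unfolding \<delta>_def distrib_right by simp
  qed
  show ?thesis
  proof (rule that[of "\<bar>b\<bar> + M'"])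
    show "\<forall>\<^sub>F (r, \<phi>) in polar_origin. 0 < r \<and> \<bar>f r - r - a * r ^ 3\<bar> \<le> \<bar>a\<bar> / 2 * r ^ 3 \<and>
       \<bar>g \<phi> r - \<phi> - \<theta>\<bar> \<le> (\<bar>b\<bar> + M') * r\<^sup>2"
      unfolding eventually_polar_origin using \<delta> main by auto
  qed (use M' in simp)
qed

text \<open>Reading a step of the map backwards turns \<open>\<theta>\<close> into \<open>- \<theta>\<close> and an expansion of the radius
  into a contraction. The bounds are given by the new radius \<open>\<rho>\<close>; they transfer to the old radius
  \<open>r\<close> because \<open>\<rho> \<le> r \<le> 2 * \<rho>\<close>, which costs a factor \<open>2 ^ 3\<close> in the lower constant.\<close>

lemma cubic_step_local_inverse:
  assumes a: "0 < a"
    and asym: "\<forall>\<^sub>F (r, \<phi>) in polar_origin. 0 < r \<and> \<bar>f r - r - a * r ^ 3\<bar> \<le> \<bar>a\<bar> / 2 * r ^ 3 \<and>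
       \<bar>g \<phi> r - \<phi> - \<theta>\<bar> \<le> C * r\<^sup>2"
    and C: "0 < C" and G: "polar_local_inverse (polar_map f g) G"
  shows "\<forall>\<^sub>F x in polar_origin. cubic_step (a / 16) (max (3 * a / 2) C) (- \<theta>) x (G x)"
proof -
  have lim: "filterlim G polar_origin polar_origin"
    and inv: "\<forall>\<^sub>F x in polar_origin. polar_map f g (G x) = x"
    using G by (auto simp: polar_local_inverse_def)
  have small: "\<forall>\<^sub>F x in polar_origin. 3 * a / 2 * (fst x)\<^sup>2 \<le> 1"
  proof -
    have "3 * a / 2 * r\<^sup>2 \<le> 1" if "0 < r" "r < sqrt (2 / (3 * a))" for r
    proof -
      have "r\<^sup>2 \<le> (sqrt (2 / (3 * a)))\<^sup>2" using that by (intro power_mono) auto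
      then show ?thesis using a by (simp add: field_simps)
    qed
    then show ?thesis unfolding eventually_polar_origin using a
      by (intro exI[of _ "sqrt (2 / (3 * a))"]) auto
  qed
  have near: "\<forall>\<^sub>F x in polar_origin. P (G x)" if "\<forall>\<^sub>F x in polar_origin. P x" for P
    using lim that by (simp add: filterlim_iff)
  show ?thesis
    using inv near[OF asym] near[OF small]
  proof eventually_elim
    case (elim x)
    obtain r \<phi> where x: "x = (r, \<phi>)" by (cases x)
    obtain \<rho> \<psi> where Gx: "G x = (\<rho>, \<psi>)" by (cases "G x")
    have fr: "f \<rho> = r" and g\<phi>: "g \<psi> \<rho> = \<phi>" using elim(1) by (auto simp: x Gx[unfolded x] polar_map_def)
    have \<rho>: "0 < \<rho>" and r: "\<bar>r - \<rho> - a * \<rho> ^ 3\<bar> \<le> a / 2 * \<rho> ^ 3"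
      and \<phi>: "\<bar>\<phi> - \<psi> - \<theta>\<bar> \<le> C * \<rho>\<^sup>2"
      using elim(2) a by (auto simp: Gx fr g\<phi>)
    have lo: "a / 2 * \<rho> ^ 3 \<le> r - \<rho>" using r by linarith
    have hi: "r - \<rho> \<le> 3 * a / 2 * \<rho> ^ 3" using r by linarith
    have "0 < a / 2 * \<rho> ^ 3" using a \<rho> by simp
    with lo have le: "\<rho> \<le> r" by linarith
    have "3 * a / 2 * \<rho>\<^sup>2 * \<rho> \<le> 1 * \<rho>"
      using elim(3) \<rho> by (intro mult_right_mono) (auto simp: Gx)
    then have "3 * a / 2 * \<rho> ^ 3 \<le> \<rho>" by (simp add: power2_eq_square power3_eq_cube mult_ac)
    with hi have "r / 2 \<le> \<rho>" by linarith
    then have "a / 2 * (r / 2) ^ 3 \<le> a / 2 * \<rho> ^ 3"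
      using a le \<rho> by (intro mult_left_mono power_mono) auto
    then have "a / 16 * r ^ 3 \<le> r - \<rho>" using lo by (simp add: power_divide)
    moreover have "3 * a / 2 * \<rho> ^ 3 \<le> max (3 * a / 2) C * r ^ 3"
      using a le \<rho> by (intro mult_mono power_mono) auto
    moreover have "C * \<rho>\<^sup>2 \<le> max (3 * a / 2) C * r\<^sup>2"
      using C le \<rho> by (intro mult_mono power_mono) auto
    ultimately show ?case
      using hi \<phi> by (simp add: cubic_step_def x Gx[unfolded x] abs_le_iff)
  qed
qed

lemma cubic_step_polar_map:
  assumes a: "a < 0"
    and asym: "\<forall>\<^sub>F (r, \<phi>) in polar_origin. 0 < r \<and> \<bar>f r - r - a * r ^ 3\<bar> \<le> \<bar>a\<bar> / 2 * r ^ 3 \<and>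
       \<bar>g \<phi> r - \<phi> - \<theta>\<bar> \<le> C * r\<^sup>2"
  shows "\<forall>\<^sub>F x in polar_origin. cubic_step (- a / 2) (max (- 3 * a / 2) C) \<theta> x (polar_map f g x)"
  using asym
proof eventually_elim
  case (elim x)
  obtain r \<phi> where x: "x = (r, \<phi>)" by (cases x)
  have r: "0 < r" and f: "\<bar>f r - r - a * r ^ 3\<bar> \<le> - a / 2 * r ^ 3"
    and g: "\<bar>g \<phi> r - \<phi> - \<theta>\<bar> \<le> C * r\<^sup>2"
    using elim a by (auto simp: x)
  have "- a / 2 * r ^ 3 \<le> r - f r" using f by linarith
  moreover have "r - f r \<le> - 3 * a / 2 * r ^ 3" using f by linarith
  moreover have "- 3 * a / 2 * r ^ 3 \<le> max (- 3 * a / 2) C * r ^ 3"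
    using r by (intro mult_right_mono max.cobounded1) simp
  moreover have "C * r\<^sup>2 \<le> max (- 3 * a / 2) C * r\<^sup>2"
    by (intro mult_right_mono max.cobounded2) simp
  ultimately show ?case
    unfolding cubic_step_def x polar_map_def using g by auto
qed

theorem theorem4:
  fixes a b \<Theta>\<^sub>0 :: real and p q :: int
    and f :: "real \<Rightarrow> real" and g :: "real \<Rightarrow> real \<Rightarrow> real"
    and G :: "real \<times> real \<Rightarrow> real \<times> real"
  assumes "a \<noteq> 0"
    and "q \<noteq> 0" and "\<Theta>\<^sub>0 = 2 * pi * of_int p / of_int q"
    and "\<forall>n\<in>{1..4::nat}. exp (\<i> * of_nat n * complex_of_real \<Theta>\<^sub>0) \<noteq> 1"
    and "(\<lambda>r. f r - (r + a * r ^ 3)) \<in> O[at_right 0](\<lambda>r. r ^ 4)"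
    and "(\<lambda>(r, \<phi>). g \<phi> r - (\<phi> + \<Theta>\<^sub>0 + b * r ^ 2)) \<in> O[polar_origin](\<lambda>(r, \<phi>). r ^ 3)"
    and "a > 0 \<Longrightarrow> polar_local_inverse (polar_map f g) G"
  shows "\<exists>r\<^sub>1>0. \<forall>r\<^sub>0 \<phi>\<^sub>0. 0 < r\<^sub>0 \<and> r\<^sub>0 < r\<^sub>1 \<longrightarrow>
           Minkowski_nondegenerate (discrete_spiral a (polar_map f g) G (r\<^sub>0, \<phi>\<^sub>0)) \<and>
           has_box_dim (discrete_spiral a (polar_map f g) G (r\<^sub>0, \<phi>\<^sub>0)) (2 / 3)"
proof -
  \<comment> \<open>\<open>q\<close> may be negative, while the number of arms is \<open>\<bar>q\<bar>\<close>.\<close>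
  define n where "n = nat \<bar>q\<bar>"
  have n: "0 < n" using assms(2) by (simp add: n_def)
  have res: "real n * \<Theta>\<^sub>0 = 2 * pi * of_int (sgn q * p)"
    using assms(2,3) by (cases "0 < q") (auto simp: n_def sgn_if)
  obtain C where C: "0 < C" and asym: "\<forall>\<^sub>F (r, \<phi>) in polar_origin.
      0 < r \<and> \<bar>f r - r - a * r ^ 3\<bar> \<le> \<bar>a\<bar> / 2 * r ^ 3 \<and> \<bar>g \<phi> r - \<phi> - \<Theta>\<^sub>0\<bar> \<le> C * r\<^sup>2"
    using polar_map_cubic_asymptotics[OF assms(1,5,6)] by blast
  show ?thesis
  proof (cases "a < 0")
    case True
    then show ?thesis
      using polar_orbit_nondegenerate_and_box_dim[OF _ n res cubic_step_polar_map[OF True asym]]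
      by (simp add: discrete_spiral_def)
  next
    case False
    then have a: "0 < a" using assms(1) by simp
    have res': "real n * (- \<Theta>\<^sub>0) = 2 * pi * of_int (- (sgn q * p))" using res by simp
    show ?thesis
      using polar_orbit_nondegenerate_and_box_dim[OF _ n res' cubic_step_local_inverse[OF a asym C assms(7)[OF a]]]
        False a by (simp add: discrete_spiral_def)
  qed
qed

end
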